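(* Let $n\ge 2$ and let $G$ be a connected graph on $n$ vertices that is not isomorphic to the star $K_{1,n-1}$. Then $H_2(K_{1,n-1})< H_2(G)$.
   Context: For a graph $G$ with at least one edge, let $L(G)=D(G)-A(G)$ be its combinatorial Laplacian and $\rho(G)=\frac{1}{\operatorname{tr}L(G)}L(G)$, with eigenvalues $\lambda_1,\dots,\lambda_n$ (with multiplicity). The R\'enyi 2-entropy of $G$ is $H_2(G)=-\log_2\sum_i\lambda_i^2$. *)

theory Defs
  imports
    "Graph_Theory.Graph_Theory"
    "Jordan_Normal_Form.Char_Poly"
    Complex_Main
begin

text \<open>
  A finite simple undirected graph is the locale predicate \<^const>\<open>graph\<close>: a finite, loop-free,
  symmetric digraph without parallel arcs. Each undirected edge is a pair of opposite arcs, so the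
  degree of a vertex is its \<^const>\<open>out_degree\<close>.
\<close>

text \<open>
  Matrices are indexed by positions in an arbitrarily chosen enumeration of the vertices. Another
  enumeration conjugates them by a permutation matrix, which does not affect the spectrum.
\<close>

definition vert_enum :: "('a, 'b) pre_digraph \<Rightarrow> 'a list" where
  "vert_enum G = (SOME vs. distinct vs \<and> set vs = verts G)"

definition degree_mat :: "('a, 'b) pre_digraph \<Rightarrow> real mat" where
  "degree_mat G = mat (card (verts G)) (card (verts G))
     (\<lambda>(i, j). if i = j then real (out_degree G (vert_enum G ! i)) else 0)"

definition adjacency_mat :: "('a, 'b) pre_digraph \<Rightarrow> real mat" where
  "adjacency_mat G = mat (card (verts G)) (card (verts G))
     (\<lambda>(i, j). if (vert_enum G ! i, vert_enum G ! j) \<in> arcs_ends G then 1 else 0)"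

definition laplacian_mat :: "('a, 'b) pre_digraph \<Rightarrow> real mat" where
  "laplacian_mat G = degree_mat G - adjacency_mat G"

definition mat_trace :: "real mat \<Rightarrow> real" where
  "mat_trace A = (\<Sum>i<dim_row A. A $$ (i, i))"

definition density_mat :: "('a, 'b) pre_digraph \<Rightarrow> real mat" where
  "density_mat G = (1 / mat_trace (laplacian_mat G)) \<cdot>\<^sub>m laplacian_mat G"

text \<open>
  Only real roots of the characteristic polynomial are collected; for a symmetric matrix, such as
  the density matrix of a graph, these are all the eigenvalues.
\<close>

definition spectrum_mset :: "real mat \<Rightarrow> real multiset" where
  "spectrum_mset A = proots (char_poly A)"

definition renyi2_entropy :: "('a, 'b) pre_digraph \<Rightarrow> real" where
  "renyi2_entropy G = - log 2 (\<Sum>x\<in>#spectrum_mset (density_mat G). x\<^sup>2)"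

end

theory Submission
  imports Defs "Jordan_Normal_Form.Schur_Decomposition"
begin

text \<open>
  Since the density matrix is symmetric, the sum of its squared eigenvalues is the trace of its
  square, which equals (sum of d(v)^2 + 2 m) / (2 m)^2, where m is the number of edges. Summing
  d(u) + d(v) over the edges uv counts every d(v)^2, and d(u) + d(v) is at most m + 1 because this
  number minus one counts the edges meeting uv; hence the sum of d(v)^2 is at most m (m + 1).
  Together with m \<ge> n - 1, this bounds the purity by that of the star. Equality forces m = n - 1 and
  pairwise intersecting edges; these form a star or a triangle, and the triangle has m = n.
\<close>

section \<open>Spectra of real symmetric matrices\<close>

text \<open>Cyclicity is what removes the conjugating matrices of a Schur decomposition from the
  trace of a square.\<close>

lemma mat_trace_mult_comm:
  assumes "A \<in> carrier_mat n m" "B \<in> carrier_mat m n"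
  shows "mat_trace (A * B) = mat_trace (B * A)"
proof -
  have "mat_trace (A * B) = (\<Sum>i<n. \<Sum>j<m. A $$ (i, j) * B $$ (j, i))"
    using assms by (auto simp: mat_trace_def scalar_prod_def lessThan_atLeast0 intro!: sum.cong)
  also have "\<dots> = (\<Sum>j<m. \<Sum>i<n. B $$ (j, i) * A $$ (i, j))"
    by (subst sum.swap) (simp add: mult.commute)
  also have "\<dots> = mat_trace (B * A)"
    using assms by (auto simp: mat_trace_def scalar_prod_def lessThan_atLeast0 intro!: sum.cong)
  finally show ?thesis .
qed

text \<open>The Hermitian form of \<open>A\<close> at an eigenvector equals \<open>k\<close> times
  the squared norm of that vector. Since \<open>A\<close> is real and symmetric, the form is its own
  conjugate, hence real; division by the positive squared norm leaves \<open>k\<close> real.\<close>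

lemma eigenvalue_symmetric_real:
  fixes A :: "real mat"
  assumes A: "A \<in> carrier_mat n n"
    and sym: "\<And>i j. i < n \<Longrightarrow> j < n \<Longrightarrow> A $$ (i, j) = A $$ (j, i)"
    and k: "eigenvalue (map_mat complex_of_real A) k"
  shows "k \<in> \<real>"
proof -
  let ?M = "map_mat complex_of_real A"
  from k obtain v where v: "v \<in> carrier_vec n" "v \<noteq> 0\<^sub>v n" "?M *\<^sub>v v = k \<cdot>\<^sub>v v"
    using A by (auto simp: eigenvalue_def eigenvector_def)
  \<comment> \<open>\<open>N\<close> is the squared norm of the eigenvector and \<open>q\<close> the
    value of the Hermitian form at it.\<close>
  define N where "N = (\<Sum>i<n. (cmod (v $ i))\<^sup>2)"
  define q where "q = (\<Sum>i<n. \<Sum>j<n. complex_of_real (A $$ (i, j)) * v $ j * cnj (v $ i))"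
  have row: "(\<Sum>j<n. complex_of_real (A $$ (i, j)) * v $ j) = k * v $ i" if "i < n" for i
  proof -
    have "(?M *\<^sub>v v) $ i = (k \<cdot>\<^sub>v v) $ i" using v by simp
    then show ?thesis
      using that A v(1) by (simp add: scalar_prod_def lessThan_atLeast0)
  qed
  have "q = (\<Sum>i<n. k * v $ i * cnj (v $ i))"
    unfolding q_def by (simp flip: sum_distrib_right add: row)
  also have "\<dots> = k * complex_of_real N"
    by (simp add: N_def sum_distrib_left mult.assoc complex_norm_square del: of_real_power)
  finally have qk: "q = k * complex_of_real N" .
  have "cnj q = (\<Sum>i<n. \<Sum>j<n. complex_of_real (A $$ (i, j)) * cnj (v $ j) * v $ i)"
    by (simp add: q_def)
  also have "\<dots> = (\<Sum>j<n. \<Sum>i<n. complex_of_real (A $$ (i, j)) * cnj (v $ j) * v $ i)"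
    by (rule sum.swap)
  also have "\<dots> = q"
    unfolding q_def by (intro sum.cong refl) (simp add: sym mult.commute mult.left_commute)
  finally have "q \<in> \<real>" by (simp add: Reals_cnj_iff)
  from v obtain i where i: "i < n" "v $ i \<noteq> 0"
    by (metis carrier_vecD eq_vecI index_zero_vec(1) index_zero_vec(2))
  have "N > 0" unfolding N_def
    by (rule sum_pos2[of _ i]) (use i in auto)
  then have "k = q / complex_of_real N" using qk by simp
  with \<open>q \<in> \<real>\<close> show ?thesis by (simp add: Reals_divide)
qed

text \<open>Over the complex numbers the characteristic polynomial splits, and all its roots are
  real, so the factorization descends along the injective embedding of real polynomials. A real
  Schur decomposition requires such a splitting.\<close>

lemma char_poly_symmetric_real_splits:
  fixes A :: "real mat"
  assumes A: "A \<in> carrier_mat n n"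
    and sym: "\<And>i j. i < n \<Longrightarrow> j < n \<Longrightarrow> A $$ (i, j) = A $$ (j, i)"
  obtains es where "char_poly A = (\<Prod>e\<leftarrow>es. [:- e, 1:])"
proof -
  let ?M = "map_mat complex_of_real A"
  have M: "?M \<in> carrier_mat n n" using A by simp
  interpret h: map_poly_inj_comm_ring_hom complex_of_real ..
  obtain as where as: "char_poly ?M = (\<Prod>a\<leftarrow>as. [:- a, 1:])"
    using char_poly_factorized[OF M] by blast
  have real: "of_real (Re a) = a" if "a \<in> set as" for a
  proof -
    have "poly (char_poly ?M) a = 0"
      using that unfolding as by (auto simp: poly_prod_list prod_list_zero_iff)
    then have "a \<in> \<real>"
      using eigenvalue_symmetric_real[OF A sym] eigenvalue_root_char_poly[OF M] by blast
    then show ?thesis by (simp add: of_real_Re)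
  qed
  have "map_poly complex_of_real (char_poly A) = char_poly ?M"
    by (rule of_real_hom.char_poly_hom[OF A, symmetric])
  also have "\<dots> = map_poly complex_of_real (\<Prod>e\<leftarrow>map Re as. [:- e, 1:])"
    unfolding as h.hom_prod_list map_map
    by (intro arg_cong[where f = prod_list] map_cong refl) (simp add: real)
  finally have "char_poly A = (\<Prod>e\<leftarrow>map Re as. [:- e, 1:])"
    by (simp only: h.eq_iff)
  then show thesis by (rule that)
qed

text \<open>Both sides are the trace of \<open>A * A\<close>. A Schur decomposition replaces
  \<open>A\<close> by an upper triangular \<open>B\<close> with the eigenvalues on its diagonal,
  which gives the left side; symmetry of \<open>A\<close> gives the right side.\<close>

lemma sum_squares_spectrum_mset:
  fixes A :: "real mat"
  assumes A: "A \<in> carrier_mat n n"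
    and sym: "\<And>i j. i < n \<Longrightarrow> j < n \<Longrightarrow> A $$ (i, j) = A $$ (j, i)"
  shows "(\<Sum>x\<in>#spectrum_mset A. x\<^sup>2) = (\<Sum>i<n. \<Sum>j<n. (A $$ (i, j))\<^sup>2)"
proof -
  obtain es where es: "char_poly A = (\<Prod>e\<leftarrow>es. [:- e, 1:])"
    using char_poly_symmetric_real_splits[OF A sym] by blast
  obtain B P Q where "schur_decomposition A es = (B, P, Q)"
    by (cases "schur_decomposition A es") auto
  from schur_decomposition[OF A es this]
  have sim: "similar_mat_wit A B P Q" and ut: "upper_triangular B" and diag: "diag_mat B = es"
    by auto
  note w = similar_mat_witD2[OF A sim]
  have spec: "spectrum_mset A = mset es"
    unfolding spectrum_mset_def es
  proof (induction es)
    case (Cons e es)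
    have "(\<Prod>e\<leftarrow>es. [:- e, 1:]) \<noteq> (0 :: real poly)" by (auto simp: prod_list_zero_iff)
    then show ?case
      using Cons proots_mult[of "[:- e, 1:]" "\<Prod>e\<leftarrow>es. [:- e, 1:]"]
      by (simp del: mult_pCons_left)
  qed simp
  have "mat_trace (A * A) = mat_trace (P * (B * B) * Q)"
    using similar_mat_wit_pow_id[OF sim, of 2] A w by (simp add: numeral_2_eq_2)
  also have "\<dots> = mat_trace (Q * (P * (B * B)))"
    using w by (intro mat_trace_mult_comm[of _ n n]) auto
  also have "Q * (P * (B * B)) = B * B"
    using w by (simp flip: assoc_mult_mat[of Q n n P n "B * B" n])
  also have "mat_trace (B * B) = (\<Sum>i<n. (B $$ (i, i))\<^sup>2)"
  proof -
    have "row B i \<bullet> col B i = (B $$ (i, i))\<^sup>2" if "i < n" for i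
    proof -
      have "row B i \<bullet> col B i = (\<Sum>j\<in>{0..<n}. B $$ (i, j) * B $$ (j, i))"
        using that w by (simp add: scalar_prod_def)
      \<comment> \<open>For distinct indices one of the two factors lies below the diagonal and
        vanishes.\<close>
      also have "\<dots> = (\<Sum>j\<in>{0..<n}. if j = i then (B $$ (i, i))\<^sup>2 else 0)"
      proof (intro sum.cong refl)
        fix j assume "j \<in> {0..<n}"
        then show "B $$ (i, j) * B $$ (j, i) = (if j = i then (B $$ (i, i))\<^sup>2 else 0)"
          using that w upper_triangularD[OF ut, of i j] upper_triangularD[OF ut, of j i]
          by (cases i j rule: linorder_cases) (auto simp: power2_eq_square)
      qed
      finally show ?thesis using that by simp
    qed
    then show ?thesis using w by (simp add: mat_trace_def)
  qed
  also have "\<dots> = (\<Sum>x\<in>#spectrum_mset A. x\<^sup>2)"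
  proof -
    have "(\<Sum>x\<in>#spectrum_mset A. x\<^sup>2) = (\<Sum>e\<leftarrow>diag_mat B. e\<^sup>2)"
      unfolding spec diag by (simp flip: mset_map sum_mset_sum_list)
    also have "\<dots> = (\<Sum>i<n. (B $$ (i, i))\<^sup>2)"
      using w by (simp add: diag_mat_def comp_def interv_sum_list_conv_sum_set_nat lessThan_atLeast0)
    finally show ?thesis ..
  qed
  finally have "(\<Sum>x\<in>#spectrum_mset A. x\<^sup>2) = mat_trace (A * A)" ..
  also have "\<dots> = (\<Sum>i<n. \<Sum>j<n. A $$ (i, j) * A $$ (j, i))"
    using A by (auto simp: mat_trace_def scalar_prod_def lessThan_atLeast0 intro!: sum.cong)
  also have "\<dots> = (\<Sum>i<n. \<Sum>j<n. (A $$ (i, j))\<^sup>2)"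
    by (intro sum.cong refl) (simp add: sym power2_eq_square)
  finally show ?thesis .
qed

section \<open>Degrees in symmetric relations\<close>

lemma sum_card_Image:
  fixes E :: "('a \<times> 'a) set"
  assumes "finite V" "E \<subseteq> V \<times> V"
  shows "(\<Sum>v\<in>V. card (E `` {v})) = card E"
proof -
  have "E = Sigma V (\<lambda>v. E `` {v})" using assms(2) by auto
  moreover have "finite (E `` {v})" for v
    using assms finite_subset[of "E `` {v}" V] by auto
  ultimately show ?thesis using assms(1) by (metis card_SigmaI)
qed

text \<open>Summed over arcs, the degree of the tail occurs once for each outgoing arc, which yields
  the squared degrees; by symmetry the heads give the same sum. The extra factor 2 fits the arc
  count at an edge, where each undirected edge appears twice.\<close>

lemma sum_card_Image_squared:
  fixes E :: "('a \<times> 'a) set"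
  assumes fin: "finite V" and EV: "E \<subseteq> V \<times> V" and "sym E"
  shows "4 * (\<Sum>v\<in>V. (card (E `` {v}))\<^sup>2) =
    (\<Sum>(u, v)\<in>E. 2 * (card (E `` {u}) + card (E `` {v})))"
proof -
  have E: "E = Sigma V (\<lambda>v. E `` {v})" using EV by auto
  have finI: "finite (E `` {v})" for v
    using EV fin finite_subset[of "E `` {v}" V] by auto
  have 1: "(\<Sum>(u, v)\<in>E. card (E `` {u})) = (\<Sum>v\<in>V. (card (E `` {v}))\<^sup>2)"
    using sum.Sigma[of V "\<lambda>v. E `` {v}" "\<lambda>u v. card (E `` {u})"] fin finI E
    by (simp add: power2_eq_square)
  have "(\<Sum>(u, v)\<in>E. card (E `` {v})) = (\<Sum>(u, v)\<in>E\<inverse>. card (E `` {u}))"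
    by (rule sum.reindex_bij_witness[of _ prod.swap prod.swap]) auto
  also have "E\<inverse> = E" using \<open>sym E\<close> by (simp add: sym_conv_converse_eq)
  finally show ?thesis
    using 1 by (simp add: case_prod_beta' sum.distrib flip: sum_distrib_left)
qed

lemma card_arcs_at:
  fixes E :: "('a \<times> 'a) set"
  assumes "finite E" "sym E" "irrefl E"
  shows "card {e \<in> E. fst e = u \<or> snd e = u} = 2 * card (E `` {u})"
proof -
  have eq: "{e \<in> E. fst e = u \<or> snd e = u} = Pair u ` (E `` {u}) \<union> (\<lambda>w. (w, u)) ` (E `` {u})"
    using assms(2) by (auto dest: symD)
  have "finite (E `` {u})" using assms(1) by (rule finite_Image)
  moreover have "Pair u ` (E `` {u}) \<inter> (\<lambda>w. (w, u)) ` (E `` {u}) = {}"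
    using assms(3) by (auto simp: irrefl_def)
  ultimately show ?thesis
    unfolding eq by (subst card_Un_disjoint) (auto simp: card_image inj_on_def)
qed

text \<open>Inclusion-exclusion for the arcs at \<open>u\<close> and the arcs at \<open>v\<close>:
  they share exactly \<open>(u, v)\<close> and \<open>(v, u)\<close>, whence the 2.\<close>

lemma card_Image_edge:
  fixes E :: "('a \<times> 'a) set"
  assumes "finite E" "sym E" "irrefl E" "(u, v) \<in> E"
  shows "2 * (card (E `` {u}) + card (E `` {v})) =
    card {e \<in> E. fst e \<in> {u, v} \<or> snd e \<in> {u, v}} + 2"
proof -
  let ?A = "\<lambda>x. {e \<in> E. fst e = x \<or> snd e = x}"
  have uv: "u \<noteq> v" "(v, u) \<in> E" using assms by (auto simp: irrefl_def dest: symD)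
  have "card (?A u) + card (?A v) = card (?A u \<union> ?A v) + card (?A u \<inter> ?A v)"
    using assms(1) by (intro card_Un_Int) auto
  moreover have "?A u \<inter> ?A v = {(u, v), (v, u)}" using uv assms(4) by auto
  moreover have "?A u \<union> ?A v = {e \<in> E. fst e \<in> {u, v} \<or> snd e \<in> {u, v}}" by auto
  ultimately show ?thesis using uv card_arcs_at[OF assms(1-3)] by simp
qed

lemma card_Image_edge_le:
  fixes E :: "('a \<times> 'a) set"
  assumes "finite E" "sym E" "irrefl E" "(u, v) \<in> E"
  shows "2 * (card (E `` {u}) + card (E `` {v})) \<le> card E + 2"
  using card_Image_edge[OF assms] card_mono[OF assms(1), of "{e \<in> E. fst e \<in> {u, v} \<or> snd e \<in> {u, v}}"]
  by auto

text \<open>With \<open>card E\<close> equal to 2m, this is the bound m (m + 1) on the sum of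
  squared degrees, multiplied by 4.\<close>

lemma sum_card_Image_squared_le:
  fixes E :: "('a \<times> 'a) set"
  assumes "finite V" "E \<subseteq> V \<times> V" "sym E" "irrefl E"
  shows "4 * (\<Sum>v\<in>V. (card (E `` {v}))\<^sup>2) \<le> card E * (card E + 2)"
proof -
  have finE: "finite E" using assms finite_subset by blast
  have "4 * (\<Sum>v\<in>V. (card (E `` {v}))\<^sup>2) = (\<Sum>(u, v)\<in>E. 2 * (card (E `` {u}) + card (E `` {v})))"
    using assms(1-3) by (rule sum_card_Image_squared)
  also have "\<dots> \<le> (\<Sum>(u, v)\<in>E. card E + 2)"
    using card_Image_edge_le[OF finE assms(3,4)] by (intro sum_mono) auto
  finally show ?thesis by (simp add: case_prod_beta')
qed

text \<open>An arc disjoint from \<open>{u, v}\<close> is missed when the arcs meeting that edge are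
  counted, so the summand at \<open>(u, v)\<close> lies strictly below its bound.\<close>

lemma sum_card_Image_squared_less:
  fixes E :: "('a \<times> 'a) set"
  assumes "finite V" "E \<subseteq> V \<times> V" "sym E" "irrefl E"
    and uv: "(u, v) \<in> E" and xy: "(x, y) \<in> E" "{u, v} \<inter> {x, y} = {}"
  shows "4 * (\<Sum>v\<in>V. (card (E `` {v}))\<^sup>2) < card E * (card E + 2)"
proof -
  have finE: "finite E" using assms finite_subset by blast
  have "{e \<in> E. fst e \<in> {u, v} \<or> snd e \<in> {u, v}} \<subset> E"
    (is "?A \<subset> E")
  proof (rule psubsetI)
    show "?A \<subseteq> E" by (rule Collect_subset)
    have "(x, y) \<in> E - ?A" using xy by auto
    then show "?A \<noteq> E" by (rule contrapos_pn) simp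
  qed
  from psubset_card_mono[OF finE this]
  have strict: "2 * (card (E `` {u}) + card (E `` {v})) < card E + 2"
    using card_Image_edge[OF finE assms(3,4) uv] by linarith
  have "4 * (\<Sum>v\<in>V. (card (E `` {v}))\<^sup>2) = (\<Sum>(u, v)\<in>E. 2 * (card (E `` {u}) + card (E `` {v})))"
    using assms(1-3) by (rule sum_card_Image_squared)
  also have "\<dots> < (\<Sum>(u, v)\<in>E. card E + 2)"
  proof (rule sum_strict_mono_ex1[OF finE])
    show "\<forall>e\<in>E. (case e of (u, v) \<Rightarrow> 2 * (card (E `` {u}) + card (E `` {v}))) \<le>
        (case e of (u, v) \<Rightarrow> card E + 2)"
      using card_Image_edge_le[OF finE assms(3,4)] by auto
    show "\<exists>e\<in>E. (case e of (u, v) \<Rightarrow> 2 * (card (E `` {u}) + card (E `` {v}))) <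
        (case e of (u, v) \<Rightarrow> card E + 2)"
      using uv strict by (intro bexI[of _ "(u, v)"]) auto
  qed
  finally show ?thesis by (simp add: case_prod_beta')
qed

section \<open>Edge counts of connected graphs and families of intersecting edges\<close>

lemma card_arcs_ge:
  fixes E :: "('a \<times> 'a) set"
  assumes fin: "finite V" and "V \<noteq> {}" and EV: "E \<subseteq> V \<times> V" and sym: "sym E"
    and conn: "\<And>T. T \<subset> V \<Longrightarrow> T \<noteq> {} \<Longrightarrow> \<exists>x\<in>T. \<exists>y\<in>V - T. (x, y) \<in> E"
  shows "2 * (card V - 1) \<le> card E"
proof -
  have finE: "finite E" using fin EV finite_subset by blast
  \<comment> \<open>A vertex set is grown from a single vertex. As long as it is proper, some arc
    leaves it; adding the far end brings in that arc and its reverse, so every new vertex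
    contributes at least two arcs.\<close>
  have "\<exists>T\<subseteq>V. card T = Suc k \<and> 2 * k \<le> card (E \<inter> T \<times> T)" if "Suc k \<le> card V" for k
    using that
  proof (induction k)
    case 0
    obtain a where "a \<in> V" using \<open>V \<noteq> {}\<close> by auto
    then show ?case by (intro exI[of _ "{a}"]) auto
  next
    case (Suc k)
    then obtain T where T: "T \<subseteq> V" "card T = Suc k" "2 * k \<le> card (E \<inter> T \<times> T)" by auto
    have "T \<subset> V" "T \<noteq> {}" using T Suc.prems by auto
    then obtain x y where xy: "x \<in> T" "y \<in> V - T" "(x, y) \<in> E" using conn by blast
    have finT: "finite T" using T fin finite_subset by blast
    have "insert (x, y) (insert (y, x) (E \<inter> T \<times> T)) \<subseteq> E \<inter> insert y T \<times> insert y T"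
      using xy sym by (auto dest: symD)
    then have "card (insert (x, y) (insert (y, x) (E \<inter> T \<times> T))) \<le> card (E \<inter> insert y T \<times> insert y T)"
      using finE by (intro card_mono) auto
    moreover have "card (insert (x, y) (insert (y, x) (E \<inter> T \<times> T))) = card (E \<inter> T \<times> T) + 2"
      using xy finE by (subst card_insert_disjoint; auto)+
    ultimately show ?case using T xy finT by (intro exI[of _ "insert y T"]) auto
  qed
  from this[of "card V - 1"] obtain T where "2 * (card V - 1) \<le> card (E \<inter> T \<times> T)"
    using \<open>V \<noteq> {}\<close> fin by (metis Suc_diff_1 card_gt_0_iff order_refl)
  also have "\<dots> \<le> card E" using finE by (intro card_mono) auto
  finally show ?thesis .
qed

text \<open>Fix an edge uv. If all edges pass through one of its ends, they form a star, because
  every vertex is covered. Otherwise each end has a neighbour off the edge, and these two neighbours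
  coincide since the edges leading to them meet. An edge meeting all three sides of the resulting
  triangle is itself a side.\<close>

lemma intersecting_arcs_star_or_triangle:
  fixes E :: "('a \<times> 'a) set"
  assumes EV: "E \<subseteq> V \<times> V" and sym: "sym E" and irr: "irrefl E"
    and cover: "\<And>v. v \<in> V \<Longrightarrow> \<exists>w. (v, w) \<in> E" and "V \<noteq> {}"
    and meet: "\<And>u v x y. (u, v) \<in> E \<Longrightarrow> (x, y) \<in> E \<Longrightarrow> {u, v} \<inter> {x, y} \<noteq> {}"
  obtains (star) c where "c \<in> V" "E = {c} \<times> (V - {c}) \<union> (V - {c}) \<times> {c}"
  | (triangle) "card V = 3" "card E = 6"
proof -
  have star': thesis if c: "c \<in> V" "\<And>x y. (x, y) \<in> E \<Longrightarrow> x = c \<or> y = c" for c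
  proof (rule star[OF c(1)])
    have "(c, w) \<in> E" if "w \<in> V" "w \<noteq> c" for w
      using cover[OF that(1)] c(2) that(2) sym by (metis symD)
    moreover from this have "(w, c) \<in> E" if "w \<in> V" "w \<noteq> c" for w
      using that sym by (meson symD)
    ultimately show "E = {c} \<times> (V - {c}) \<union> (V - {c}) \<times> {c}"
      using c EV irr by (auto simp: irrefl_def)
  qed
  obtain u v where uv: "(u, v) \<in> E" using cover \<open>V \<noteq> {}\<close> by blast
  then have uvV: "u \<in> V" "v \<in> V" "u \<noteq> v" using EV irr by (auto simp: irrefl_def)
  \<comment> \<open>An edge avoiding \<open>b\<close> must still meet the edge ab, hence contains
    \<open>a\<close>; its other end serves as \<open>w\<close>.\<close>
  have nbr: "\<exists>w. (a, w) \<in> E \<and> w \<noteq> b"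
    if nstar: "\<not> (\<forall>x y. (x, y) \<in> E \<longrightarrow> x = b \<or> y = b)" and ab: "(a, b) \<in> E" for a b
  proof -
    obtain x y where xy: "(x, y) \<in> E" "x \<noteq> b" "y \<noteq> b" using nstar by auto
    then have "x = a \<or> y = a" using meet[OF ab xy(1)] by auto
    then show ?thesis using xy sym by (auto dest: symD)
  qed
  show thesis
  proof (cases "(\<forall>x y. (x, y) \<in> E \<longrightarrow> x = u \<or> y = u) \<or> (\<forall>x y. (x, y) \<in> E \<longrightarrow> x = v \<or> y = v)")
    case True
    then show thesis using star' uvV by blast
  next
    case False
    then obtain x y where x: "(u, x) \<in> E" "x \<noteq> v" and y: "(v, y) \<in> E" "y \<noteq> u"
      using nbr[of v u] nbr[of u v] uv sym by (meson symD)
    have "x = y" using meet[OF x(1) y(1)] x y uvV by auto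
    then have vx: "(v, x) \<in> E" using y by simp
    have ne: "x \<noteq> u" "x \<noteq> v" using x irr by (auto simp: irrefl_def)
    have tri: "a \<in> {u, v, x} \<and> b \<in> {u, v, x} \<and> a \<noteq> b" if "(a, b) \<in> E" for a b
    proof -
      have "a \<noteq> b" using that irr by (auto simp: irrefl_def)
      then show ?thesis
        using meet[OF that uv] meet[OF that x(1)] meet[OF that vx] ne uvV(3) by auto
    qed
    have E: "E = {(u, v), (v, u), (u, x), (x, u), (v, x), (x, v)}"
    proof
      show "E \<subseteq> {(u, v), (v, u), (u, x), (x, u), (v, x), (x, v)}" using tri by fast
      show "{(u, v), (v, u), (u, x), (x, u), (v, x), (x, v)} \<subseteq> E"
        using uv x(1) vx symD[OF sym] by simp
    qed
    have "V = {u, v, x}"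
    proof
      show "V \<subseteq> {u, v, x}" using tri cover by fast
      show "{u, v, x} \<subseteq> V" using EV uvV x(1) by auto
    qed
    then have "card V = 3" using ne uvV by auto
    moreover have "card E = 6" unfolding E using ne uvV by auto
    ultimately show thesis by (rule triangle)
  qed
qed

section \<open>Laplacian spectra and stars\<close>

context graph
begin

lemma arcs_ends_subset: "arcs_ends G \<subseteq> verts G \<times> verts G"
  by (auto simp: arcs_ends_conv)

lemma sym_arcs_ends: "sym (arcs_ends G)"
  using sym_arcs by (simp add: symmetric_def)

lemma irrefl_arcs_ends: "irrefl (arcs_ends G)"
  using no_loops by (force simp: irrefl_def arcs_ends_conv)

text \<open>Without parallel arcs, \<open>head G\<close> is injective on the arcs leaving
  \<open>v\<close>. This carries the counts for symmetric relations over to graphs.\<close>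

lemma out_degree_eq_card_Image: "out_degree G v = card (arcs_ends G `` {v})"
proof -
  have "arcs_ends G `` {v} = head G ` out_arcs G v"
    by (auto simp: arcs_ends_conv image_iff)
  moreover have "inj_on (head G) (out_arcs G v)"
    using no_multi_arcs by (auto simp: inj_on_def arc_to_ends_def)
  ultimately show ?thesis by (simp add: out_degree_def card_image)
qed

lemma bij_betw_vert_enum: "bij_betw ((!) (vert_enum G)) {..<card (verts G)} (verts G)"
proof -
  have "distinct (vert_enum G) \<and> set (vert_enum G) = verts G"
    unfolding vert_enum_def
    by (rule someI_ex) (use finite_distinct_list[OF finite_verts] in blast)
  then show ?thesis
    by (metis bij_betw_nth distinct_card)
qed

text \<open>A connected symmetric digraph is strongly connected, so a vertex of \<open>T\<close>
  reaches one outside. If no arc left \<open>T\<close>, induction along reachability would keep that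
  vertex in \<open>T\<close>.\<close>

lemma connected_edge_leaving:
  assumes conn: "Digraph_Component.connected G" and T: "T \<subset> verts G" "T \<noteq> {}"
  shows "\<exists>x\<in>T. \<exists>y\<in>verts G - T. (x, y) \<in> arcs_ends G"
proof (rule ccontr)
  assume closed: "\<not> ?thesis"
  obtain a b where ab: "a \<in> T" "b \<in> verts G - T" using T by auto
  have "strongly_connected G"
    using symmetric_connected_imp_strongly_connected sym_arcs conn by blast
  then have "a \<rightarrow>\<^sup>* b" using ab T by (auto simp: strongly_connected_def)
  then have "b \<in> T"
  proof (induction rule: reachable_induct)
    case base show ?case by (rule ab(1))
  next
    case (step x y)
    then have "y \<in> verts G" using arcs_ends_subset by auto
    then show ?case using step closed by auto
  qed
  then show False using ab by simp
qed

end

section \<open>Isomorphisms and degree sums of stars\<close>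

lemma digraph_isoI_arcs_ends:
  assumes "graph G" "graph H"
    and f: "bij_betw f (verts G) (verts H)"
    and E: "arcs_ends H = map_prod f f ` arcs_ends G"
  shows "digraph_iso G H"
proof -
  interpret G: graph G by fact
  interpret H: graph H by fact
  \<comment> \<open>An isomorphism also needs a map on arcs. As \<open>H\<close> has no parallel
    arcs, an arc is determined by its pair of ends, so the vertex map induces
    \<open>g\<close>.\<close>
  define g where "g a = the_inv_into (arcs H) (arc_to_ends H) (map_prod f f (arc_to_ends G a))" for a
  have inj: "inj_on (arc_to_ends H) (arcs H)" by (rule H.inj_on_arc_to_ends)
  have mem: "map_prod f f (arc_to_ends G a) \<in> arc_to_ends H ` arcs H" if "a \<in> arcs G" for a
    using E that by (auto simp: arcs_ends_def)
  have ends: "arc_to_ends H (g a) = map_prod f f (arc_to_ends G a)" if "a \<in> arcs G" for a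
    unfolding g_def by (rule f_the_inv_into_f[OF inj mem[OF that]])
  have g_in: "g a \<in> arcs H" if "a \<in> arcs G" for a
    unfolding g_def by (rule the_inv_into_into[OF inj mem[OF that]]) simp
  have finj: "inj_on f (verts G)" using f by (rule bij_betw_imp_inj_on)
  have ginj: "inj_on g (arcs G)"
  proof (rule inj_onI)
    fix a b assume ab: "a \<in> arcs G" "b \<in> arcs G" "g a = g b"
    then have "map_prod f f (arc_to_ends G a) = map_prod f f (arc_to_ends G b)"
      using ends by metis
    then have "arc_to_ends G a = arc_to_ends G b"
      using ab finj by (auto simp: arc_to_ends_def dest: inj_onD)
    then show "a = b" using ab G.no_multi_arcs by blast
  qed
  have "g ` arcs G = arcs H"
  proof
    show "g ` arcs G \<subseteq> arcs H" using g_in by auto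
    show "arcs H \<subseteq> g ` arcs G"
    proof
      fix b assume b: "b \<in> arcs H"
      then have "arc_to_ends H b \<in> map_prod f f ` arcs_ends G" using E by (auto simp: arcs_ends_def)
      then obtain a where a: "a \<in> arcs G" "arc_to_ends H b = map_prod f f (arc_to_ends G a)"
        unfolding arcs_ends_def by (elim imageE) simp
      then have "g a = b" using ends inj g_in b by (metis inj_onD)
      then show "b \<in> g ` arcs G" using a by auto
    qed
  qed
  \<comment> \<open>The head and tail functions are those of \<open>H\<close> itself, since
    \<open>H = app_iso h G\<close> is an equality of records and thus concerns these functions
    beyond the arcs too.\<close>
  define h where "h = \<lparr>iso_verts = f, iso_arcs = g, iso_head = head H, iso_tail = tail H\<rparr>"
  have "pre_digraph.digraph_isomorphism G h"
    using finj ginj ends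
    by (auto simp: pre_digraph.digraph_isomorphism_def h_def arc_to_ends_def G.wf_digraph)
  moreover have "H = app_iso h G"
    using \<open>g ` arcs G = arcs H\<close> bij_betw_imp_surj_on[OF f]
    by (intro pre_digraph.equality) (simp_all add: h_def)
  ultimately show ?thesis unfolding digraph_iso_def by blast
qed

text \<open>Any bijection between the leaves, extended by sending centre to centre, preserves the
  arcs.\<close>

lemma star_digraph_iso:
  assumes "graph G" "graph H" "card (verts G) = card (verts H)"
    and c: "c \<in> verts G" "arcs_ends G = {c} \<times> (verts G - {c}) \<union> (verts G - {c}) \<times> {c}"
    and d: "d \<in> verts H" "arcs_ends H = {d} \<times> (verts H - {d}) \<union> (verts H - {d}) \<times> {d}"
  shows "digraph_iso G H"
proof -
  interpret G: graph G by fact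
  interpret H: graph H by fact
  have "card (verts G - {c}) = card (verts H - {d})"
    using assms by simp
  then obtain f where f: "bij_betw f (verts G - {c}) (verts H - {d})"
    using finite_same_card_bij G.finite_verts H.finite_verts by (metis finite_Diff)
  define g where "g = f(c := d)"
  have im: "g ` (verts G - {c}) = verts H - {d}"
    using bij_betw_imp_surj_on[OF f] by (auto simp: g_def image_def)
  have "bij_betw g (verts G - {c}) (verts H - {d})"
    using f by (rule bij_betw_cong[THEN iffD1, rotated]) (simp add: g_def)
  then have "bij_betw g (insert c (verts G - {c})) (insert d (verts H - {d}))"
    using notIn_Un_bij_betw[of c "verts G - {c}" g "verts H - {d}"] by (simp add: g_def)
  then have "bij_betw g (verts G) (verts H)" using c(1) d(1) by (simp add: insert_absorb)
  moreover have "map_prod g g ` arcs_ends G = arcs_ends H"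
  proof -
    have "map_prod g g ` (A \<times> B) = g ` A \<times> g ` B" for A B by auto
    then show ?thesis unfolding c(2) d(2) image_Un by (simp add: im) (simp add: g_def)
  qed
  ultimately show ?thesis using digraph_isoI_arcs_ends[OF assms(1,2)] by metis
qed

lemma star_degree_sums:
  assumes "graph S" and c: "c \<in> verts S"
    and E: "arcs_ends S = {c} \<times> (verts S - {c}) \<union> (verts S - {c}) \<times> {c}"
  shows "(\<Sum>v\<in>verts S. out_degree S v) = 2 * (card (verts S) - 1)"
    and "(\<Sum>v\<in>verts S. (out_degree S v)\<^sup>2) = (card (verts S) - 1)\<^sup>2 + (card (verts S) - 1)"
proof -
  interpret graph S by fact
  have "arcs_ends S `` {c} = verts S - {c}" unfolding E by auto
  then have dc: "out_degree S c = card (verts S) - 1"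
    using c by (simp add: out_degree_eq_card_Image)
  have "arcs_ends S `` {v} = {c}" if "v \<in> verts S - {c}" for v
    unfolding E using that by auto
  then have dv: "out_degree S v = 1" if "v \<in> verts S - {c}" for v
    using that by (simp add: out_degree_eq_card_Image)
  show "(\<Sum>v\<in>verts S. out_degree S v) = 2 * (card (verts S) - 1)"
    "(\<Sum>v\<in>verts S. (out_degree S v)\<^sup>2) = (card (verts S) - 1)\<^sup>2 + (card (verts S) - 1)"
    using c by (simp_all add: sum.remove[OF finite_verts c] dc dv)
qed

section \<open>The entropy in terms of degrees\<close>

lemma (in graph) renyi2_entropy_eq:
  "renyi2_entropy G = - log 2
     (((\<Sum>v\<in>verts G. (real (out_degree G v))\<^sup>2) + (\<Sum>v\<in>verts G. real (out_degree G v))) /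
      (\<Sum>v\<in>verts G. real (out_degree G v))\<^sup>2)"
proof -
  define n where "n = card (verts G)"
  define t where "t = (\<Sum>v\<in>verts G. real (out_degree G v))"
  let ?w = "(!) (vert_enum G)"
  let ?L = "laplacian_mat G"
  have bij: "bij_betw ?w {..<n} (verts G)" using bij_betw_vert_enum by (simp add: n_def)
  have L: "?L \<in> carrier_mat n n"
    by (intro carrier_matI) (simp_all add: laplacian_mat_def degree_mat_def adjacency_mat_def n_def)
  have entry: "?L $$ (i, j) = (if i = j then real (out_degree G (?w i))
      else if (?w i, ?w j) \<in> arcs_ends G then -1 else 0)" if "i < n" "j < n" for i j
    using that irrefl_arcs_ends
    by (auto simp: laplacian_mat_def degree_mat_def adjacency_mat_def n_def irrefl_def)
  have tr: "mat_trace ?L = t"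
    using L sum.reindex_bij_betw[OF bij, of "\<lambda>v. real (out_degree G v)"]
    by (simp add: mat_trace_def entry t_def)
  have symL: "?L $$ (i, j) = ?L $$ (j, i)" if "i < n" "j < n" for i j
    using that sym_arcs_ends by (auto simp: entry dest: symD)
  \<comment> \<open>The diagonal entry contributes the squared degree, and each neighbour
    contributes one squared entry -1. The adjacency indicator vanishes on the diagonal because there
    are no loops.\<close>
  have row: "(\<Sum>j<n. (?L $$ (i, j))\<^sup>2) = (real (out_degree G (?w i)))\<^sup>2 + real (out_degree G (?w i))"
    if i: "i < n" for i
  proof -
    let ?a = "\<lambda>v. if (?w i, v) \<in> arcs_ends G then 1 else (0 :: real)"
    have "(\<Sum>j<n. (?L $$ (i, j))\<^sup>2) =
        (\<Sum>j<n. (if j = i then (real (out_degree G (?w i)))\<^sup>2 else 0) + ?a (?w j))"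
      using i irrefl_arcs_ends by (intro sum.cong refl) (auto simp: entry irrefl_def)
    also have "\<dots> = (real (out_degree G (?w i)))\<^sup>2 + (\<Sum>j<n. ?a (?w j))"
      using i by (simp add: sum.distrib)
    also have "(\<Sum>j<n. ?a (?w j)) = (\<Sum>v\<in>verts G. ?a v)"
      by (rule sum.reindex_bij_betw[OF bij])
    also have "\<dots> = real (card {v \<in> verts G. (?w i, v) \<in> arcs_ends G})"
      by (simp add: sum.If_cases Int_def)
    also have "{v \<in> verts G. (?w i, v) \<in> arcs_ends G} = arcs_ends G `` {?w i}"
      using arcs_ends_subset by auto
    finally show ?thesis by (simp add: out_degree_eq_card_Image)
  qed
  have "(\<Sum>x\<in>#spectrum_mset (density_mat G). x\<^sup>2) =
      (\<Sum>i<n. \<Sum>j<n. (density_mat G $$ (i, j))\<^sup>2)"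
    using L symL by (intro sum_squares_spectrum_mset) (auto simp: density_mat_def)
  \<comment> \<open>For an edgeless graph \<open>t\<close> is 0, and both sides are 0 by the
    convention for division by zero.\<close>
  also have "\<dots> = (\<Sum>i<n. \<Sum>j<n. (?L $$ (i, j))\<^sup>2) / t\<^sup>2"
    using L by (simp add: density_mat_def tr sum_divide_distrib power_divide)
  also have "(\<Sum>i<n. \<Sum>j<n. (?L $$ (i, j))\<^sup>2) =
      (\<Sum>i<n. (real (out_degree G (?w i)))\<^sup>2 + real (out_degree G (?w i)))"
    by (simp add: row)
  also have "\<dots> = (\<Sum>v\<in>verts G. (real (out_degree G v))\<^sup>2 + real (out_degree G v))"
    by (rule sum.reindex_bij_betw[OF bij])
  finally show ?thesis by (simp add: renyi2_entropy_def t_def sum.distrib)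
qed

section \<open>Comparison of a connected graph with the star\<close>

theorem theorem3p8:
  fixes n :: nat
    and G :: "('a, 'b) pre_digraph"
    and S :: "('c, 'd) pre_digraph"
  assumes "n \<ge> 2"
    and "graph G"
    and "card (verts G) = n"
    and "Digraph_Component.connected G"
    and "complete_bipartite_digraph 1 (n - 1) S"
    and "\<not> digraph_iso G S"
  shows "renyi2_entropy S < renyi2_entropy G"
proof -
  interpret G: graph G by fact
  obtain U W where S: "graph S" and UW: "verts S = U \<union> W" "U \<inter> W = {}" "card U = 1" "card W = n - 1"
    "arcs_ends S = U \<times> W \<union> W \<times> U"
    using assms(5) unfolding complete_bipartite_digraph_def by blast
  interpret S: graph S by (rule S)
  obtain c where c: "U = {c}" using UW(3) card_1_singletonE by blast
  have cS: "c \<in> verts S" and W: "verts S - {c} = W" using UW(1,2) c by auto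
  have ES: "arcs_ends S = {c} \<times> (verts S - {c}) \<union> (verts S - {c}) \<times> {c}"
    using UW(5) W c by simp
  have "card (verts S) = Suc (card (verts S - {c}))"
    using cS by (intro card.remove) auto
  then have nS: "card (verts S) = n" using W UW(4) assms(1) by simp

  \<comment> \<open>\<open>k\<close> is the number of edges of the star. \<open>M\<close> counts
    arcs, so it is twice the number of edges of \<open>G\<close>.\<close>
  define k where "k = n - 1"
  have k: "k \<ge> 1" using assms(1) by (simp add: k_def)
  let ?E = "arcs_ends G"
  define M where "M = card ?E"
  define D where "D = (\<Sum>v\<in>verts G. (out_degree G v)\<^sup>2)"
  have V: "verts G \<noteq> {}" using assms(1,3) by auto
  have degsum: "(\<Sum>v\<in>verts G. out_degree G v) = M"
    unfolding M_def G.out_degree_eq_card_Image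
    by (rule sum_card_Image) (use G.arcs_ends_subset in auto)
  have leave: "\<And>T. T \<subset> verts G \<Longrightarrow> T \<noteq> {} \<Longrightarrow> \<exists>x\<in>T. \<exists>y\<in>verts G - T. (x, y) \<in> ?E"
    by (rule G.connected_edge_leaving[OF assms(4)])
  have Mk: "2 * k \<le> M"
    using card_arcs_ge[OF G.finite_verts V G.arcs_ends_subset G.sym_arcs_ends leave]
    by (simp add: M_def k_def assms(3))
  have D_le: "4 * D \<le> M * (M + 2)"
    unfolding D_def M_def G.out_degree_eq_card_Image
    using G.arcs_ends_subset G.sym_arcs_ends G.irrefl_arcs_ends
    by (intro sum_card_Image_squared_le) auto
  have strict: "4 * D < M * (M + 2) \<or> 2 * k < M"
  proof (rule ccontr)
    assume neg: "\<not> ?thesis"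
    then have M: "M = 2 * k" using Mk by simp
    have meet: "{u, v} \<inter> {x, y} \<noteq> {}" if "(u, v) \<in> ?E" "(x, y) \<in> ?E" for u v x y
    proof
      assume "{u, v} \<inter> {x, y} = {}"
      from sum_card_Image_squared_less[OF G.finite_verts G.arcs_ends_subset G.sym_arcs_ends
          G.irrefl_arcs_ends that this]
      show False using neg by (simp add: D_def M_def G.out_degree_eq_card_Image)
    qed
    have cover: "\<exists>w. (v, w) \<in> ?E" if "v \<in> verts G" for v
    proof -
      have "verts G \<noteq> {v}" using assms(1,3) by (auto dest: arg_cong[where f = card])
      then have "{v} \<subset> verts G" using that by auto
      from leave[OF this] show ?thesis by auto
    qed
    show False
    proof (rule intersecting_arcs_star_or_triangle[OF G.arcs_ends_subset G.sym_arcs_ends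
          G.irrefl_arcs_ends cover V meet])
      fix d
      assume "d \<in> verts G" "?E = {d} \<times> (verts G - {d}) \<union> (verts G - {d}) \<times> {d}"
      from star_digraph_iso[OF assms(2) S _ this cS ES] show False
        using assms(3,6) nS by simp
    next
      \<comment> \<open>Three vertices give \<open>k = 2\<close>, so \<open>M\<close> would be 4
        rather than 6.\<close>
      assume "card (verts G) = 3" "card ?E = 6"
      then show False using M assms(3) by (simp add: M_def k_def)
    qed
  qed

  have "M > 0" using Mk k by simp
  \<comment> \<open>This is the purity inequality with denominators cleared. It is \<open>k\<close>
    times the degree bound plus \<open>3 * M\<close> times the edge bound, at least one of them
    strict, after cancelling \<open>2 * k * M\<close>.\<close>
  have "4 * k * D + 4 * k * M < (k + 3) * M\<^sup>2"
  proof -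
    have 1: "k * (4 * D) \<le> k * (M * (M + 2))" using D_le by simp
    have 2: "3 * M * (2 * k) \<le> 3 * M * M" using Mk by simp
    from strict have "k * (4 * D) < k * (M * (M + 2)) \<or> 3 * M * (2 * k) < 3 * M * M"
      using k \<open>M > 0\<close> by simp
    then have "k * (4 * D) + 3 * M * (2 * k) < k * (M * (M + 2)) + 3 * M * M"
      using 1 2 by linarith
    then show ?thesis by (simp add: algebra_simps power2_eq_square)
  qed
  then have "real (4 * k * D + 4 * k * M) < real ((k + 3) * M\<^sup>2)" by (simp only: of_nat_less_iff)
  then have less: "(real D + real M) / (real M)\<^sup>2 < (real k + 3) / (4 * real k)"
    using k \<open>M > 0\<close> by (simp add: divide_simps) (simp add: algebra_simps)

  have HG: "renyi2_entropy G = - log 2 ((real D + real M) / (real M)\<^sup>2)"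
    unfolding G.renyi2_entropy_eq D_def degsum[symmetric] by simp
  have sums: "(\<Sum>v\<in>verts S. real (out_degree S v)) = 2 * real k"
    "(\<Sum>v\<in>verts S. (real (out_degree S v))\<^sup>2) = (real k)\<^sup>2 + real k"
    using star_degree_sums[OF S cS ES, folded of_nat_eq_iff[where 'a = real]]
    by (simp_all add: nS k_def)
  have "((real k)\<^sup>2 + real k + 2 * real k) / (2 * real k)\<^sup>2 = (real k + 3) / (4 * real k)"
    using k by (simp add: field_simps power2_eq_square)
  then have HS: "renyi2_entropy S = - log 2 ((real k + 3) / (4 * real k))"
    unfolding S.renyi2_entropy_eq sums by simp
  \<comment> \<open>Positivity of the smaller purity lets the strict monotonicity of the logarithm
    apply.\<close>
  have "0 < (real D + real M) / (real M)\<^sup>2" using \<open>M > 0\<close> by simp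
  then show ?thesis unfolding HG HS using less by simp
qed

end
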